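(* Let $\tilde{Y}$ be a compact (not necessarily Hausdorff) topological space and let $\tilde{g}:\tilde{Y}\to\tilde{Y}$ be a continuous, surjective, open map such that $(\tilde{Y},\tilde{g})$ is forward orbit expansive. Suppose there exist a pair $(Y,g)$ and a map $r:\tilde{Y}\to Y$ such that (1) $Y$ is a compact Hausdorff space; (2) $g:Y\to Y$ is continuous and onto; (3) $r$ is continuous, onto, and $r\circ\tilde{g}=g\circ r$; (4) there exists $L\in\mathbb{N}$ such that for each $y\in Y$ the set $\tilde{g}^L(r^{-1}(y))$ is a singleton. Then the solenoids associated to $(\tilde{Y},\tilde{g})$ and to $(Y,g)$ are conjugate. In particular, the solenoid associated to $(\tilde{Y},\tilde{g})$ is Hausdorff.
   Context: Compact means every open cover has a finite subcover (no Hausdorff assumption). $(\tilde{Y},\tilde{g})$ is forward orbit expansive if there is a finite open cover $\mathcal{U}=\{U_i\}_{i=1}^l$ of $\tilde{Y}$ such that whenever $x,y\in\tilde{Y}$ have the property that for each $n\in\mathbb{N}=\{0,1,2,\dots\}$ there is $i_n$ with $\tilde{g}^n(x),\tilde{g}^n(y)\in U_{i_n}$, then $x=y$. The solenoid associated to a pair $(Z,f)$ with $f:Z\to Z$ a continuous surjection is the space $\varprojlim(Z,f)=\{(z_0,z_1,z_2,\dots): z_i\in Z,\ f(z_{i+1})=z_i \text{ for all } i\ge 0\}$ with the subspace topology from the product topology, together with the homeomorphism $(z_0,z_1,z_2,\dots)\mapsto(f(z_0),z_0,z_1,\dots)$. Two solenoids are conjugate if there is a homeomorphism between them intertwining these homeomorphisms.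 *)

theory Defs
  imports "HOL-Analysis.Analysis"
begin

text \<open>Spaces are abstract topologies, so maps are only relevant on \<open>topspace\<close>; the empty
  space is allowed.\<close>

definition forward_orbit_expansive :: "'a topology \<Rightarrow> ('a \<Rightarrow> 'a) \<Rightarrow> bool" where
  "forward_orbit_expansive X g \<longleftrightarrow>
    (\<exists>\<U>. finite \<U> \<and> (\<forall>U\<in>\<U>. openin X U) \<and> \<Union>\<U> = topspace X \<and>
      (\<forall>x\<in>topspace X. \<forall>y\<in>topspace X.
        (\<forall>n. \<exists>U\<in>\<U>. (g ^^ n) x \<in> U \<and> (g ^^ n) y \<in> U) \<longrightarrow> x = y))"

text \<open>Intended for \<open>f\<close> a continuous surjection of \<open>X\<close> onto itself. The points of the solenoid
  lie in \<open>topspace X\<close> coordinatewise because the subspace is taken in the product topology.\<close>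

definition solenoid :: "'a topology \<Rightarrow> ('a \<Rightarrow> 'a) \<Rightarrow> (nat \<Rightarrow> 'a) topology" where
  "solenoid X f =
    subtopology (product_topology (\<lambda>_. X) UNIV) {z. \<forall>i. f (z (Suc i)) = z i}"

definition solenoid_map :: "('a \<Rightarrow> 'a) \<Rightarrow> (nat \<Rightarrow> 'a) \<Rightarrow> (nat \<Rightarrow> 'a)" where
  "solenoid_map f z = (\<lambda>n. case n of 0 \<Rightarrow> f (z 0) | Suc k \<Rightarrow> z k)"

definition conjugate_solenoids ::
  "'a topology \<Rightarrow> ('a \<Rightarrow> 'a) \<Rightarrow> 'b topology \<Rightarrow> ('b \<Rightarrow> 'b) \<Rightarrow> bool" where
  "conjugate_solenoids X f Y g \<longleftrightarrow>
    (\<exists>h. homeomorphic_map (solenoid X f) (solenoid Y g) h \<and>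
      (\<forall>z\<in>topspace (solenoid X f). h (solenoid_map f z) = solenoid_map g (h z)))"

lemma topspace_solenoid:
  "topspace (solenoid X f) = {z. (\<forall>i. z i \<in> topspace X) \<and> (\<forall>i. f (z (Suc i)) = z i)}"
  by (auto simp: solenoid_def PiE_def Pi_def)

lemma continuous_map_into_solenoid:
  "continuous_map T (solenoid X f) h \<longleftrightarrow>
    (\<forall>i. continuous_map T X (\<lambda>t. h t i)) \<and> (\<forall>t\<in>topspace T. \<forall>i. f (h t (Suc i)) = h t i)"
  by (auto simp: solenoid_def continuous_map_in_subtopology continuous_map_componentwise_UNIV)

lemma homeomorphic_map_solenoid_map:
  assumes "continuous_map X X f"
  shows "homeomorphic_map (solenoid X f) (solenoid X f) (solenoid_map f)"
proof -
  have proj: "continuous_map (solenoid X f) X (\<lambda>z. z i)" for i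
    using continuous_map_into_solenoid[of "solenoid X f" X f id] by simp
  have "continuous_map (solenoid X f) X (\<lambda>z. f (z 0))"
    using continuous_map_compose[OF proj assms] by (simp add: o_def)
  then have "continuous_map (solenoid X f) X (\<lambda>z. solenoid_map f z i)" for i
    using proj by (cases i) (simp_all add: solenoid_map_def)
  then have "continuous_map (solenoid X f) (solenoid X f) (solenoid_map f)"
    by (auto simp: continuous_map_into_solenoid solenoid_map_def topspace_solenoid
        split: nat.splits)
  moreover have "continuous_map (solenoid X f) (solenoid X f) (\<lambda>z n. z (Suc n))"
    using proj by (auto simp: continuous_map_into_solenoid topspace_solenoid)
  ultimately have "homeomorphic_maps (solenoid X f) (solenoid X f) (solenoid_map f) (\<lambda>z n. z (Suc n))"
    by (auto simp: homeomorphic_maps_def topspace_solenoid solenoid_map_def fun_eq_iff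
        split: nat.splits)
  then show ?thesis
    using homeomorphic_maps_map by blast
qed

end

theory Submission
  imports Defs
begin

text \<open>Applying \<open>r\<close> coordinatewise maps one solenoid to the other. By (4), \<open>gt ^^ L\<close> factors as
  \<open>s \<circ> r\<close>; as \<open>r\<close> is a closed map from a compact space onto a Hausdorff space, it is a quotient
  map, so \<open>s\<close> is continuous. The inverse of \<open>r\<close> on solenoids is \<open>y \<mapsto> (s (y (i + L)))\<^sub>i\<close>.\<close>

text \<open>This lets an n-fold iterate be absorbed by a shift of index, so that maps inverse to
  each other only up to \<open>f ^^ n\<close> become true inverses on solenoids.\<close>

lemma solenoid_funpow:
  assumes "z \<in> topspace (solenoid X f)"
  shows "(f ^^ n) (z (i + n)) = z i"
  using assms by (induction n arbitrary: i) (auto simp: topspace_solenoid funpow_swap1)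

lemma continuous_map_solenoid_proj: "continuous_map (solenoid X f) X (\<lambda>z. z i)"
  using continuous_map_into_solenoid[of "solenoid X f" X f id] by simp

lemma Hausdorff_space_solenoid: "Hausdorff_space Y \<Longrightarrow> Hausdorff_space (solenoid Y g)"
  unfolding solenoid_def by (simp add: Hausdorff_space_subtopology Hausdorff_space_product_topology)

text \<open>Choosing any preimage under \<open>q\<close> and applying \<open>f\<close> gives a
  well-defined \<open>s\<close>, since \<open>f\<close> is constant on fibres;
  \<open>s \<circ> q\<close> agrees with \<open>f\<close>, and the quotient topology turns its
  continuity into that of \<open>s\<close>.\<close>

lemma continuous_factor_through_quotient_map:
  assumes q: "quotient_map X Y q" and f: "continuous_map X Z f"
    and const: "\<And>x x'. x \<in> topspace X \<Longrightarrow> x' \<in> topspace X \<Longrightarrow> q x = q x' \<Longrightarrow> f x = f x'"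
  obtains s where "continuous_map Y Z s" "\<And>x. x \<in> topspace X \<Longrightarrow> s (q x) = f x"
proof -
  define s where "s = f \<circ> inv_into (topspace X) q"
  have s: "s (q x) = f x" if "x \<in> topspace X" for x
    unfolding s_def o_apply
    by (rule const) (use that in \<open>auto simp: f_inv_into_f intro: inv_into_into\<close>)
  have "continuous_map X Z (s \<circ> q)"
    using f by (rule continuous_map_eq) (simp add: s)
  then have "continuous_map Y Z s"
    using continuous_compose_quotient_map_eq[OF q] by blast
  with s that show thesis by blast
qed

text \<open>The pair \<open>r\<close>, \<open>s\<close> is a shift equivalence of lag
  \<open>n\<close>: surjectivity of \<open>r\<close> yields the missing relations for
  \<open>s\<close>, and passing to solenoids removes the lag.\<close>

lemma conjugate_solenoids_factor:
  assumes r: "continuous_map X Y r" and s: "continuous_map Y X s"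
    and onto: "r ` topspace X = topspace Y"
    and rf: "\<And>x. x \<in> topspace X \<Longrightarrow> r (f x) = g (r x)"
    and f: "continuous_map X X f"
    and sr: "\<And>x. x \<in> topspace X \<Longrightarrow> s (r x) = (f ^^ n) x"
  shows "conjugate_solenoids X f Y g"
proof -
  have fn: "(f ^^ k) x \<in> topspace X" if "x \<in> topspace X" for k x
    using that f by (induction k) (auto simp: continuous_map_def)
  have rfn: "r ((f ^^ k) x) = (g ^^ k) (r x)" if "x \<in> topspace X" for k x
    using that by (induction k) (auto simp: rf fn)
  have rs: "r (s y) = (g ^^ n) y" and sg: "s (g y) = f (s y)" if "y \<in> topspace Y" for y
  proof -
    have "y \<in> r ` topspace X"
      using that by (simp add: onto)
    then obtain x where x: "x \<in> topspace X" "y = r x"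
      by blast
    then show "r (s y) = (g ^^ n) y"
      by (simp add: sr rfn)
    \<comment> \<open>Here \<open>g y = g (r x) = r (f x)\<close>, so \<open>sr\<close> applies at
      the point \<open>f x\<close>.\<close>
    have "s (g y) = (f ^^ n) (f x)"
      using x fn[of x 1] by (simp add: sr flip: rf)
    then show "s (g y) = f (s y)"
      using x by (simp add: sr funpow_swap1)
  qed
  \<comment> \<open>Reading coordinate \<open>i + n\<close> instead of \<open>i\<close> cancels the
    iterate: both \<open>(f ^^ n) (z (i + n)) = z i\<close> and
    \<open>(g ^^ n) (y (i + n)) = y i\<close>.\<close>
  let ?h = "\<lambda>z i. r (z i)" and ?k = "\<lambda>y i. s (y (i + n))"
  have "continuous_map (solenoid X f) (solenoid Y g) ?h"
    unfolding continuous_map_into_solenoid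
    using continuous_map_compose[OF continuous_map_solenoid_proj r]
    by (auto simp: topspace_solenoid o_def simp flip: rf)
  moreover have "continuous_map (solenoid Y g) (solenoid X f) ?k"
    unfolding continuous_map_into_solenoid
    using continuous_map_compose[OF continuous_map_solenoid_proj s]
    by (auto simp: topspace_solenoid o_def simp flip: sg)
  moreover have "?k (?h z) = z" if "z \<in> topspace (solenoid X f)" for z
    using that solenoid_funpow[OF that] by (auto simp: sr topspace_solenoid)
  moreover have "?h (?k y) = y" if "y \<in> topspace (solenoid Y g)" for y
    using that solenoid_funpow[OF that] by (auto simp: rs topspace_solenoid)
  ultimately have "homeomorphic_maps (solenoid X f) (solenoid Y g) ?h ?k"
    by (simp add: homeomorphic_maps_def)
  then have "homeomorphic_map (solenoid X f) (solenoid Y g) ?h"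
    using homeomorphic_maps_map by blast
  moreover have "?h (solenoid_map f z) = solenoid_map g (?h z)"
    if "z \<in> topspace (solenoid X f)" for z
    using that by (auto simp: solenoid_map_def topspace_solenoid rf fun_eq_iff split: nat.splits)
  ultimately show ?thesis
    unfolding conjugate_solenoids_def by blast
qed

theorem theorem3p9:
  fixes X :: "'a topology" and gt :: "'a \<Rightarrow> 'a"
    and Y :: "'b topology" and g :: "'b \<Rightarrow> 'b" and r :: "'a \<Rightarrow> 'b"
  assumes "compact_space X"
    and "continuous_map X X gt" and "gt ` topspace X = topspace X" and "open_map X X gt"
    and "forward_orbit_expansive X gt"
    and "compact_space Y" and "Hausdorff_space Y"
    and "continuous_map Y Y g" and "g ` topspace Y = topspace Y"
    and "continuous_map X Y r" and "r ` topspace X = topspace Y"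
    and "\<forall>x\<in>topspace X. r (gt x) = g (r x)"
    and "\<exists>L::nat. \<forall>y\<in>topspace Y. \<exists>p. (gt ^^ L) ` {x \<in> topspace X. r x = y} = {p}"
  shows "conjugate_solenoids X gt Y g \<and> Hausdorff_space (solenoid X gt)"
proof -
  obtain L where L: "\<forall>y\<in>topspace Y. \<exists>p. (gt ^^ L) ` {x \<in> topspace X. r x = y} = {p}"
    using assms by blast
  \<comment> \<open>Two points of one fibre of \<open>r\<close> both go to the single point that
    hypothesis (4) assigns to that fibre.\<close>
  have const: "(gt ^^ L) x = (gt ^^ L) x'"
    if x: "x \<in> topspace X" "x' \<in> topspace X" "r x = r x'" for x x'
  proof -
    have "r x \<in> topspace Y"
      using x assms(11) by blast
    then obtain p where "(gt ^^ L) ` {w \<in> topspace X. r w = r x} = {p}"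
      using L by blast
    then have "(gt ^^ L) w = p" if "w \<in> topspace X" "r w = r x" for w
      using that by blast
    with x show ?thesis by simp
  qed
  have "quotient_map X Y r"
    using assms by (intro continuous_imp_quotient_map)
  moreover have "continuous_map X X (gt ^^ k)" for k
  proof (induction k)
    case (Suc k)
    then show ?case
      using continuous_map_compose[OF Suc.IH assms(2)] by (simp add: o_def)
  qed simp
  ultimately obtain s where s: "continuous_map Y X s"
    and sr: "\<And>x. x \<in> topspace X \<Longrightarrow> s (r x) = (gt ^^ L) x"
    using continuous_factor_through_quotient_map const by blast
  then have conj: "conjugate_solenoids X gt Y g"
    using conjugate_solenoids_factor[OF assms(10) s assms(11) _ assms(2) sr] assms(12) by blast
  then have "solenoid X gt homeomorphic_space solenoid Y g"
    unfolding conjugate_solenoids_def using homeomorphic_map_imp_homeomorphic_space by blast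
  \<comment> \<open>The property is pulled back from the solenoid of \<open>Y\<close>, a subspace of
    a product of Hausdorff spaces; \<open>X\<close> itself may fail to be Hausdorff.\<close>
  then have "Hausdorff_space (solenoid X gt)"
    using homeomorphic_Hausdorff_space Hausdorff_space_solenoid[OF assms(7)] by blast
  with conj show ?thesis ..
qed

end
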